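(* Let $S$ be a Tychonoff topological semigroup whose square $S\times S$ is pseudocompact. Then $S$ embeds (as a topological semigroup) into a compact Hausdorff topological semigroup, and the following conditions hold: (i) the inversion $\operatorname{inv}\colon H(S)\to H(S)$ is continuous; (ii) the projection $\pi\colon H(S)\to E(S)$ is continuous; (iii) for each idempotent $e\in E(S)$ the maximal subgroup $H(e)$ (with the subspace topology) is a totally bounded topological group.
   Context: All topological spaces are assumed Hausdorff. A topological semigroup is a topological space with a continuous associative binary operation. A space $X$ is pseudocompact if every continuous real-valued function on $X$ is bounded. $E(S)$ denotes the set of idempotents of a semigroup $S$; for $e\in E(S)$, $H(e)$ is the maximal subgroup of $S$ with identity $e$; $H(S)=\bigcup_{e\in E(S)}H(e)$. The inversion $\operatorname{inv}\colon H(S)\to H(S)$ sends $x\in H(e)$ to its inverse $x^{-1}$ in the group $H(e)$, and the projection $\pi\colon H(S)\to E(S)$ is $\pi(x)=xx^{-1}$. Here $H(S)$ and $E(S)$ carry the subspace topologies from $S$. A topological group $G$ is totally bounded if for any open neighbourhood $U$ of the identity there is a finite subset $A\subseteq G$ with $A\cdot U=G$. *)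

theory Defs
  imports "HOL-Analysis.Analysis" "HOL-Algebra.Coset"
begin

text \<open>Closure of \<open>topspace X\<close> under \<open>m\<close> is part of the \<open>continuous_map\<close> condition.\<close>

definition topological_semigroup :: "'a topology \<Rightarrow> ('a \<Rightarrow> 'a \<Rightarrow> 'a) \<Rightarrow> bool" where
  "topological_semigroup X m \<longleftrightarrow>
     Hausdorff_space X \<and>
     continuous_map (prod_topology X X) X (\<lambda>(x, y). m x y) \<and>
     (\<forall>x\<in>topspace X. \<forall>y\<in>topspace X. \<forall>z\<in>topspace X. m (m x y) z = m x (m y z))"

definition tychonoff_space :: "'a topology \<Rightarrow> bool" where
  "tychonoff_space X \<longleftrightarrow> completely_regular_space X \<and> Hausdorff_space X"

definition pseudocompact_space :: "'a topology \<Rightarrow> bool" where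
  "pseudocompact_space X \<longleftrightarrow>
     (\<forall>f. continuous_map X euclideanreal f \<longrightarrow> bounded (f ` topspace X))"

definition semigroup_embedding ::
  "'a topology \<Rightarrow> ('a \<Rightarrow> 'a \<Rightarrow> 'a) \<Rightarrow> 'b topology \<Rightarrow> ('b \<Rightarrow> 'b \<Rightarrow> 'b) \<Rightarrow> ('a \<Rightarrow> 'b) \<Rightarrow> bool" where
  "semigroup_embedding X m K n h \<longleftrightarrow>
     embedding_map X K h \<and>
     (\<forall>x\<in>topspace X. \<forall>y\<in>topspace X. h (m x y) = n (h x) (h y))"

definition idempotents :: "'a topology \<Rightarrow> ('a \<Rightarrow> 'a \<Rightarrow> 'a) \<Rightarrow> 'a set" where
  "idempotents X m = {e \<in> topspace X. m e e = e}"

definition subgroup_at :: "'a topology \<Rightarrow> ('a \<Rightarrow> 'a \<Rightarrow> 'a) \<Rightarrow> 'a \<Rightarrow> 'a set \<Rightarrow> bool" where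
  "subgroup_at X m e G \<longleftrightarrow>
     G \<subseteq> topspace X \<and> Group.group \<lparr>carrier = G, mult = m, one = e\<rparr>"

text \<open>The union of all subgroups with identity \<open>e\<close>; for idempotent \<open>e\<close> it is itself such a
  subgroup, hence the largest one (\<open>maximal_subgroup_greatest\<close> below).\<close>

definition maximal_subgroup :: "'a topology \<Rightarrow> ('a \<Rightarrow> 'a \<Rightarrow> 'a) \<Rightarrow> 'a \<Rightarrow> 'a set" where
  "maximal_subgroup X m e = \<Union>{G. subgroup_at X m e G}"

definition maximal_group :: "'a topology \<Rightarrow> ('a \<Rightarrow> 'a \<Rightarrow> 'a) \<Rightarrow> 'a \<Rightarrow> 'a monoid" where
  "maximal_group X m e = \<lparr>carrier = maximal_subgroup X m e, mult = m, one = e\<rparr>"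

definition clifford_part :: "'a topology \<Rightarrow> ('a \<Rightarrow> 'a \<Rightarrow> 'a) \<Rightarrow> 'a set" where
  "clifford_part X m = (\<Union>e\<in>idempotents X m. maximal_subgroup X m e)"

text \<open>The \<open>THE\<close> is well defined on \<open>clifford_part X m\<close>, see \<open>maximal_subgroup_unique\<close> below.\<close>

definition inversion :: "'a topology \<Rightarrow> ('a \<Rightarrow> 'a \<Rightarrow> 'a) \<Rightarrow> 'a \<Rightarrow> 'a" where
  "inversion X m x =
     m_inv (maximal_group X m (THE e. e \<in> idempotents X m \<and> x \<in> maximal_subgroup X m e)) x"

definition projection :: "'a topology \<Rightarrow> ('a \<Rightarrow> 'a \<Rightarrow> 'a) \<Rightarrow> 'a \<Rightarrow> 'a" where
  "projection X m x = m x (inversion X m x)"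

definition topological_group :: "'a topology \<Rightarrow> 'a monoid \<Rightarrow> bool" where
  "topological_group T G \<longleftrightarrow>
     Group.group G \<and> carrier G = topspace T \<and> Hausdorff_space T \<and>
     continuous_map (prod_topology T T) T (\<lambda>(x, y). x \<otimes>\<^bsub>G\<^esub> y) \<and>
     continuous_map T T (\<lambda>x. inv\<^bsub>G\<^esub> x)"

definition totally_bounded_group :: "'a topology \<Rightarrow> 'a monoid \<Rightarrow> bool" where
  "totally_bounded_group T G \<longleftrightarrow>
     topological_group T G \<and>
     (\<forall>U. openin T U \<and> \<one>\<^bsub>G\<^esub> \<in> U \<longrightarrow>
        (\<exists>A. finite A \<and> A \<subseteq> carrier G \<and> A <#>\<^bsub>G\<^esub> U = carrier G))"

lemma subgroup_at_units:
  assumes S: "topological_semigroup X m" and e: "e \<in> idempotents X m"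
  defines "V \<equiv> {x \<in> topspace X. m e x = x \<and> m x e = x \<and>
      (\<exists>y\<in>topspace X. m e y = y \<and> m y e = y \<and> m x y = e \<and> m y x = e)}"
  shows "subgroup_at X m e V" and "subgroup_at X m e G \<Longrightarrow> G \<subseteq> V"
proof -
  have cl: "m x y \<in> topspace X" if "x \<in> topspace X" "y \<in> topspace X" for x y
  proof -
    have "(\<lambda>(x, y). m x y) \<in> topspace X \<times> topspace X \<rightarrow> topspace X"
      using S unfolding topological_semigroup_def continuous_map_def by simp
    from Pi_mem[OF this, of "(x, y)"] show ?thesis using that by simp
  qed
  have as: "m (m x y) z = m x (m y z)"
    if "x \<in> topspace X" "y \<in> topspace X" "z \<in> topspace X" for x y z
    using S that unfolding topological_semigroup_def by blast
  have e': "e \<in> topspace X" "m e e = e" using e by (auto simp: idempotents_def)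
  have mV: "m x y \<in> V" if xy: "x \<in> V" "y \<in> V" for x y
  proof -
    from xy obtain x' y' where
      x: "x \<in> topspace X" "m e x = x" "m x e = x" "x' \<in> topspace X" "m e x' = x'" "m x' e = x'"
         "m x x' = e" "m x' x = e" and
      y: "y \<in> topspace X" "m e y = y" "m y e = y" "y' \<in> topspace X" "m e y' = y'" "m y' e = y'"
         "m y y' = e" "m y' y = e"
      unfolding V_def by blast
    have "m (m x y) (m y' x') = m x (m (m y y') x')"
      using x y as[of x y "m y' x'"] as[of y y' x'] by (simp add: cl)
    then have 1: "m (m x y) (m y' x') = e" using x y by simp
    have "m (m y' x') (m x y) = m y' (m (m x' x) y)"
      using x y as[of y' x' "m x y"] as[of x' x y] by (simp add: cl)
    then have 2: "m (m y' x') (m x y) = e" using x y by simp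
    have 3: "m e (m x y) = m x y" "m (m x y) e = m x y"
      "m e (m y' x') = m y' x'" "m (m y' x') e = m y' x'"
      using x y e' as[of e x y] as[of e y' x'] as[of x y e] as[of y' x' e] by auto
    show ?thesis unfolding V_def using 1 2 3 cl x y by blast
  qed
  have "Group.group \<lparr>carrier = V, mult = m, one = e\<rparr>"
  proof (rule groupI; simp)
    show "m x y \<in> V" if "x \<in> V" "y \<in> V" for x y using mV that .
    show "e \<in> V" using e' by (auto simp: V_def)
    show "m (m x y) z = m x (m y z)" if "x \<in> V" "y \<in> V" "z \<in> V" for x y z
      using as that by (auto simp: V_def)
    show "m e x = x" if "x \<in> V" for x using that by (auto simp: V_def)
    show "\<exists>y\<in>V. m y x = e" if "x \<in> V" for x using that by (auto simp: V_def)
  qed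
  then show "subgroup_at X m e V" by (auto simp: subgroup_at_def V_def)
  show "G \<subseteq> V" if G: "subgroup_at X m e G"
  proof
    fix x assume x: "x \<in> G"
    interpret G: Group.group "\<lparr>carrier = G, mult = m, one = e\<rparr>"
      using G by (simp add: subgroup_at_def)
    have "G \<subseteq> topspace X" using G by (simp add: subgroup_at_def)
    moreover obtain y where "y \<in> G" "m x y = e" "m y x = e"
      using x G.inv_closed[of x] G.r_inv[of x] G.l_inv[of x] by auto
    moreover have "m e z = z \<and> m z e = z" if "z \<in> G" for z
      using that G.l_one[of z] G.r_one[of z] by simp
    ultimately show "x \<in> V" using x unfolding V_def by blast
  qed
qed

lemma maximal_subgroup_greatest:
  assumes "topological_semigroup X m" "e \<in> idempotents X m"
  shows "subgroup_at X m e (maximal_subgroup X m e)"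
    and "subgroup_at X m e G \<Longrightarrow> G \<subseteq> maximal_subgroup X m e"
proof -
  note V = subgroup_at_units[OF assms]
  have "maximal_subgroup X m e = {x \<in> topspace X. m e x = x \<and> m x e = x \<and>
      (\<exists>y\<in>topspace X. m e y = y \<and> m y e = y \<and> m x y = e \<and> m y x = e)}"
    unfolding maximal_subgroup_def
  proof (rule antisym)
    show "\<Union>{G. subgroup_at X m e G} \<subseteq> {x \<in> topspace X. m e x = x \<and> m x e = x \<and>
      (\<exists>y\<in>topspace X. m e y = y \<and> m y e = y \<and> m x y = e \<and> m y x = e)}"
      by (rule Union_least) (use V(2) in blast)
  next
    show "{x \<in> topspace X. m e x = x \<and> m x e = x \<and>
      (\<exists>y\<in>topspace X. m e y = y \<and> m y e = y \<and> m x y = e \<and> m y x = e)}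
      \<subseteq> \<Union>{G. subgroup_at X m e G}"
      by (rule Union_upper) (use V(1) in simp)
  qed
  with V(1) show "subgroup_at X m e (maximal_subgroup X m e)" by simp
  show "subgroup_at X m e G \<Longrightarrow> G \<subseteq> maximal_subgroup X m e"
    by (auto simp: maximal_subgroup_def)
qed

lemma maximal_subgroup_unique:
  assumes S: "topological_semigroup X m" and "e \<in> idempotents X m" "f \<in> idempotents X m"
    and "x \<in> maximal_subgroup X m e" "x \<in> maximal_subgroup X m f"
  shows "e = f"
proof -
  have as: "m (m x y) z = m x (m y z)"
    if "x \<in> topspace X" "y \<in> topspace X" "z \<in> topspace X" for x y z
    using S that unfolding topological_semigroup_def by blast
  have *: "x \<in> topspace X \<and> m g x = x \<and> m x g = x \<and> (\<exists>y\<in>topspace X. m x y = g \<and> m y x = g)"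
    if "g \<in> idempotents X m" "x \<in> maximal_subgroup X m g" for g
    using subgroup_at_units(2)[OF S that(1) maximal_subgroup_greatest(1)[OF S that(1)]] that(2)
    by blast
  obtain y z where "x \<in> topspace X" "y \<in> topspace X" "z \<in> topspace X"
    "m x y = e" "m y x = e" "m x z = f" "m z x = f" "m e x = x" "m x f = x"
    using *[of e] *[of f] assms by blast
  moreover have "e \<in> topspace X" "f \<in> topspace X"
    using assms by (auto simp: idempotents_def)
  ultimately show "e = f" using as[of e x z] as[of y x f] by simp
qed

end

theory Submission
  imports Defs
begin

text \<open>
  The compact semigroup is the Stone-Cech compactification \<open>K\<close> of \<open>X\<close>. By Glicksberg's argument, for
  continuous \<open>f\<close> on the pseudocompact square the map \<open>x \<mapsto> f(x, \<cdot>)\<close> is sup-norm continuous, since a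
  failure at a point produces a sequence of open boxes without cluster point. Hence the pseudometric
  \<open>d(x, x') = sup\<^sub>y \<bar>f(x, y) - f(x', y)\<bar>\<close> is continuous and totally bounded, which makes \<open>f\<close> uniformly
  continuous for the uniformity generated by the continuous functions \<open>X \<rightarrow> [0, 1]\<close>. Applied to
  \<open>f(x, y) = g(xy)\<close> this extends the multiplication to \<open>K \<times> K\<close>.

  In \<open>K\<close> the relation ``\<open>y\<close> is a group inverse of \<open>x\<close>'' is closed, so the inversion has a closed graph
  with values in a compact space and is continuous. Total boundedness of \<open>H(e)\<close> follows by covering the
  compact set \<open>{(x, y). y x = e}\<close> with boxes \<open>A \<times> B\<close> such that \<open>B A\<close> lies in a given neighbourhood of \<open>e\<close>.
\<close>

subsection \<open>Pseudocompact products\<close>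

text \<open>If the family \<open>U\<close> were locally finite, bumps of height \<open>n\<close> at
  a point of \<open>U n\<close>, vanishing off \<open>U n\<close>, would add up to a continuous
  unbounded function.\<close>

lemma pseudocompact_space_cluster_point:
  assumes "completely_regular_space X" "pseudocompact_space X"
    and "\<And>n::nat. openin X (U n)" "\<And>n. U n \<noteq> {}"
  obtains x where "x \<in> topspace X"
    "\<And>V. openin X V \<Longrightarrow> x \<in> V \<Longrightarrow> infinite {n. U n \<inter> V \<noteq> {}}"
proof (rule ccontr)
  assume "\<not> thesis"
  with that have lf: "\<exists>V. openin X V \<and> x \<in> V \<and> finite {n. U n \<inter> V \<noteq> {}}"
    if "x \<in> topspace X" for x
    using \<open>x \<in> topspace X\<close> by metis
  have "\<forall>n. \<exists>p. p \<in> U n" using assms(4) by blast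
  then obtain p where p: "\<And>n. p n \<in> U n" by metis
  have "\<exists>f. continuous_map X (top_of_set {0..1::real}) f \<and> f (p n) = 0 \<and>
      f ` (topspace X - U n) \<subseteq> {1}" for n
  proof -
    have "closedin X (topspace X - U n) \<and> p n \<in> topspace X - (topspace X - U n)"
      using assms(3)[of n] p[of n] openin_subset by fastforce
    then show ?thesis using assms(1) unfolding completely_regular_space_def by blast
  qed
  then obtain f where f: "\<And>n. continuous_map X (top_of_set {0..1::real}) (f n)"
    "\<And>n. f n (p n) = 0" "\<And>n. f n ` (topspace X - U n) \<subseteq> {1}" by metis
  have fc: "continuous_map X euclideanreal (f n)" for n
    using f(1) by (simp add: continuous_map_in_subtopology)
  have f01: "f n x \<in> {0..1}" if "x \<in> topspace X" for n x
    using f(1)[of n] that by (force simp: continuous_map_in_subtopology)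
  \<comment> \<open>\<open>g n\<close> takes the value \<open>n\<close> at \<open>p n\<close>, is
    nonnegative, and vanishes off \<open>U n\<close>.\<close>
  define g where "g = (\<lambda>n x. real n * (1 - f n x))"
  have gc: "continuous_map X euclideanreal (g n)" for n
    unfolding g_def by (intro continuous_intros fc) auto
  have g0: "g n x = 0" if "x \<in> topspace X" "x \<notin> U n" for n x
  proof -
    have "f n x = 1" using that f(3)[of n] by blast
    then show ?thesis by (simp add: g_def)
  qed
  have gnn: "g n x \<ge> 0" if "x \<in> topspace X" for n x
    using f01[OF that, of n] by (simp add: g_def)
  \<comment> \<open>The index set varies with \<open>x\<close>. On an open \<open>V\<close> meeting
    only finitely many \<open>U n\<close>, the extra terms vanish and \<open>G\<close> is the fixed
    finite sum over \<open>N V\<close>, so continuity can be pasted together from such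
    \<open>V\<close>.\<close>
  define G where "G = (\<lambda>x. \<Sum>n\<in>{n. x \<in> U n}. g n x)"
  define N where "N = (\<lambda>V. {n. U n \<inter> V \<noteq> {}})"
  have GV: "G x = (\<Sum>n\<in>N V. g n x)" if "x \<in> topspace X" "x \<in> V" "finite (N V)" for x V
    unfolding G_def
    by (rule sum.mono_neutral_left) (use that g0 in \<open>auto simp: N_def\<close>)
  have "continuous_map X euclideanreal G"
  proof (rule pasting_lemma[where I = "{V. openin X V \<and> finite (N V)}" and T = "\<lambda>V. V"
        and f = "\<lambda>V x. \<Sum>n\<in>N V. g n x"])
    show "continuous_map (subtopology X V) euclideanreal (\<lambda>x. \<Sum>n\<in>N V. g n x)"
      if "V \<in> {V. openin X V \<and> finite (N V)}" for V
      using that by (intro continuous_map_sum) (auto intro: continuous_map_from_subtopology gc)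
    show "(\<Sum>n\<in>N V. g n x) = (\<Sum>n\<in>N W. g n x)"
      if "V \<in> {V. openin X V \<and> finite (N V)}" "W \<in> {V. openin X V \<and> finite (N V)}"
        "x \<in> topspace X \<inter> V \<inter> W" for V W x
      using that GV[of x V] GV[of x W] by simp
    show "\<exists>V. V \<in> {V. openin X V \<and> finite (N V)} \<and> x \<in> V \<and> G x = (\<Sum>n\<in>N V. g n x)"
      if "x \<in> topspace X" for x
      using lf[OF that] GV[OF that] unfolding N_def by blast
  qed auto
  then have "bounded (G ` topspace X)"
    using assms(2) by (simp add: pseudocompact_space_def)
  then obtain B where B: "\<And>x. x \<in> topspace X \<Longrightarrow> \<bar>G x\<bar> \<le> B"
    unfolding bounded_iff by auto
  obtain n :: nat where n: "real n > B" using reals_Archimedean2 by blast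
  have pX: "p n \<in> topspace X" using p assms(3) openin_subset by blast
  obtain V where V: "openin X V" "p n \<in> V" "finite (N V)"
    using lf[OF pX] unfolding N_def by blast
  \<comment> \<open>All other terms at \<open>p n\<close> are nonnegative, so \<open>G (p n)\<close>
    is at least \<open>n\<close>, which exceeds the bound \<open>B\<close>.\<close>
  have "g n (p n) \<le> (\<Sum>k\<in>N V. g k (p n))"
    by (rule member_le_sum) (use V p[of n] gnn pX in \<open>auto simp: N_def\<close>)
  then have "real n \<le> G (p n)" using GV[OF pX V(2,3)] f(2) by (simp add: g_def)
  with B[OF pX] n show False by linarith
qed

lemma continuous_map_real_nbhd:
  fixes f :: "'a \<Rightarrow> real"
  assumes "continuous_map X euclideanreal f" "a \<in> topspace X" "e > 0"
  obtains U where "openin X U" "a \<in> U" "\<And>x. x \<in> U \<Longrightarrow> \<bar>f x - f a\<bar> < e"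
proof
  show "openin X {x \<in> topspace X. f x \<in> ball (f a) e}"
    using assms(1) by (rule openin_continuous_map_preimage) simp
qed (use assms in \<open>auto simp: dist_real_def\<close>)

lemma continuous_map_real_prod_nbhd:
  fixes f :: "'a \<times> 'b \<Rightarrow> real"
  assumes "continuous_map (prod_topology X Y) euclideanreal f"
    and "a \<in> topspace X" "b \<in> topspace Y" "e > 0"
  obtains U V where "openin X U" "openin Y V" "a \<in> U" "b \<in> V"
    "\<And>x y. x \<in> U \<Longrightarrow> y \<in> V \<Longrightarrow> \<bar>f (x, y) - f (a, b)\<bar> < e"
proof -
  have ab: "(a, b) \<in> topspace (prod_topology X Y)" using assms by simp
  obtain W where W: "openin (prod_topology X Y) W" "(a, b) \<in> W"
    "\<And>z. z \<in> W \<Longrightarrow> \<bar>f z - f (a, b)\<bar> < e"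
    by (rule continuous_map_real_nbhd[OF assms(1) ab assms(4)]) blast
  from W(1) have "\<forall>x y. (x, y) \<in> W \<longrightarrow> (\<exists>U V. openin X U \<and> openin Y V \<and> x \<in> U \<and> y \<in> V \<and> U \<times> V \<subseteq> W)"
    unfolding openin_prod_topology_alt .
  then obtain U V where UV: "openin X U" "openin Y V" "a \<in> U" "b \<in> V" "U \<times> V \<subseteq> W"
    using W(2) by meson
  show ?thesis
  proof (rule that[OF UV(1-4)])
    show "\<bar>f (x, y) - f (a, b)\<bar> < e" if "x \<in> U" "y \<in> V" for x y
      using W(3)[of "(x, y)"] UV(5) that by blast
  qed
qed

text \<open>If no neighbourhood of \<open>a\<close> works, shrinking neighbourhoods
  \<open>U n\<close> of \<open>a\<close> and boxes \<open>V n \<times> W n\<close> with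
  \<open>V n \<subseteq> U n\<close> can be chosen so that over \<open>W n\<close> the values of
  \<open>f\<close> on \<open>V n\<close> and on \<open>U (Suc n)\<close> stay apart. Later boxes
  have their first factor inside \<open>U (Suc n)\<close>, so near a cluster point both kinds of
  values would occur close together.\<close>

lemma pseudocompact_prod_equicontinuous:
  fixes f :: "'a \<times> 'b \<Rightarrow> real"
  assumes cr: "completely_regular_space (prod_topology X Y)"
    and pc: "pseudocompact_space (prod_topology X Y)"
    and f: "continuous_map (prod_topology X Y) euclideanreal f"
    and a: "a \<in> topspace X" and e: "e > 0"
  obtains U where "openin X U" "a \<in> U"
    "\<And>x y. x \<in> U \<Longrightarrow> y \<in> topspace Y \<Longrightarrow> \<bar>f (x, y) - f (a, y)\<bar> < e"
proof (rule ccontr)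
  assume "\<not> thesis"
  with that have bad: "\<exists>x\<in>U. \<exists>y\<in>topspace Y. \<bar>f (x, y) - f (a, y)\<bar> \<ge> e"
    if "openin X U" "a \<in> U" for U
    using that by (meson not_le)
  have e4: "e/4 > 0" using e by simp
  \<comment> \<open>One stage of the recursion: from the neighbourhood \<open>U\<close> of
    \<open>a\<close> to a smaller one \<open>U'\<close> and a box \<open>V \<times> W\<close>. On
    \<open>V \<times> W\<close> the function is near \<open>s\<close>, on
    \<open>U' \<times> W\<close> it is near \<open>t\<close>, and \<open>s\<close>, \<open>t\<close>
    differ by at least \<open>e\<close>.\<close>
  define Q where "Q = (\<lambda>U (U', V, W). openin X U' \<and> a \<in> U' \<and> U' \<subseteq> U \<and>
      openin X V \<and> V \<noteq> {} \<and> V \<subseteq> U \<and> openin Y W \<and> W \<noteq> {} \<and>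
      (\<exists>s t. (\<forall>x\<in>V. \<forall>y\<in>W. \<bar>f (x, y) - s\<bar> < e/4) \<and> (\<forall>x\<in>U'. \<forall>y\<in>W. \<bar>f (x, y) - t\<bar> < e/4) \<and>
        \<bar>s - t\<bar> \<ge> e))"
  have "\<exists>T. Q U T" if U: "openin X U" "a \<in> U" for U
  proof -
    obtain x y where xy: "x \<in> U" "y \<in> topspace Y" "\<bar>f (x, y) - f (a, y)\<bar> \<ge> e"
      using bad[OF U] by blast
    have x: "x \<in> topspace X" using xy U openin_subset by blast
    obtain V W where VW: "openin X V" "openin Y W" "x \<in> V" "y \<in> W"
      "\<And>x' y'. x' \<in> V \<Longrightarrow> y' \<in> W \<Longrightarrow> \<bar>f (x', y') - f (x, y)\<bar> < e/4"
      using continuous_map_real_prod_nbhd[OF f x xy(2) e4] by metis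
    obtain V' W' where VW': "openin X V'" "openin Y W'" "a \<in> V'" "y \<in> W'"
      "\<And>x' y'. x' \<in> V' \<Longrightarrow> y' \<in> W' \<Longrightarrow> \<bar>f (x', y') - f (a, y)\<bar> < e/4"
      using continuous_map_real_prod_nbhd[OF f a xy(2) e4] by metis
    \<comment> \<open>Here \<open>s = f (x, y)\<close> and \<open>t = f (a, y)\<close>; intersecting
      \<open>W\<close> with \<open>W'\<close> makes both estimates hold over the same second
      factor.\<close>
    have "Q U (U \<inter> V', U \<inter> V, W \<inter> W')"
      unfolding Q_def prod.case using U VW VW' xy by blast
    then show ?thesis ..
  qed
  then have "\<exists>F. \<forall>U. openin X U \<and> a \<in> U \<longrightarrow> Q U (F U)" by (intro choice) blast
  then obtain F where F: "\<And>U. openin X U \<Longrightarrow> a \<in> U \<Longrightarrow> Q U (F U)" by blast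
  define U where "U = rec_nat (topspace X) (\<lambda>_ S. fst (F S))"
  have U0: "U 0 = topspace X" and US: "U (Suc n) = fst (F (U n))" for n by (simp_all add: U_def)
  have Ua: "openin X (U n) \<and> a \<in> U n" for n
  proof (induction n)
    case (Suc n)
    then have "Q (U n) (F (U n))" using F by blast
    then show ?case unfolding US Q_def by (auto split: prod.splits)
  qed (use a U0 in auto)
  define V where "V n = fst (snd (F (U n)))" for n
  define W where "W n = snd (snd (F (U n)))" for n
  have QU: "Q (U n) (U (Suc n), V n, W n)" for n
    using F[of "U n"] Ua[of n] unfolding US V_def W_def by simp
  have QD: "U (Suc n) \<subseteq> U n" "openin X (V n)" "V n \<noteq> {}" "V n \<subseteq> U n" "openin Y (W n)" "W n \<noteq> {}"
    "\<exists>s t. (\<forall>x\<in>V n. \<forall>y\<in>W n. \<bar>f (x, y) - s\<bar> < e/4) \<and>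
        (\<forall>x\<in>U (Suc n). \<forall>y\<in>W n. \<bar>f (x, y) - t\<bar> < e/4) \<and> \<bar>s - t\<bar> \<ge> e" for n
    using QU[of n] unfolding Q_def prod.case by simp_all
  have "decseq U" by (rule decseq_SucI) (rule QD)
  then have VU: "V k \<subseteq> U (Suc n)" if "n < k" for n k
    using QD(4)[of k] that decseqD[of U "Suc n" k] by auto
  have "openin (prod_topology X Y) (V n \<times> W n)" "V n \<times> W n \<noteq> {}" for n
    using QD(2,3,5,6)[of n] by (simp_all add: openin_prod_Times_iff)
  note cl = pseudocompact_space_cluster_point[OF cr pc, of "\<lambda>n. V n \<times> W n", OF this]
  obtain z where z: "z \<in> topspace (prod_topology X Y)"
    "\<And>A. openin (prod_topology X Y) A \<Longrightarrow> z \<in> A \<Longrightarrow> infinite {n. (V n \<times> W n) \<inter> A \<noteq> {}}"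
    by (rule cl) blast
  obtain x y where xy: "z = (x, y)" "x \<in> topspace X" "y \<in> topspace Y" using z(1) by (cases z) auto
  obtain A B where AB: "openin X A" "openin Y B" "x \<in> A" "y \<in> B"
    "\<And>x' y'. x' \<in> A \<Longrightarrow> y' \<in> B \<Longrightarrow> \<bar>f (x', y') - f (x, y)\<bar> < e/4"
    using continuous_map_real_prod_nbhd[OF f xy(2,3) e4] by metis
  define J where "J = {n. (V n \<times> W n) \<inter> (A \<times> B) \<noteq> {}}"
  have "infinite J"
    unfolding J_def by (rule z(2)) (use AB(1-4) xy in \<open>simp_all add: openin_prod_Times_iff\<close>)
  then obtain n where "n \<in> J" by (metis ex_in_conv finite.emptyI)
  obtain k where "k \<in> J" "n < k" using \<open>infinite J\<close> infinite_nat_iff_unbounded by blast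
  \<comment> \<open>The point \<open>(u, v)\<close> comes from the earlier box. From the later box
    only the first coordinate \<open>w\<close> is kept and paired with \<open>v\<close>: since
    \<open>w\<close> lies in \<open>U (Suc n)\<close>, the value \<open>f (w, v)\<close> is near
    \<open>t\<close>.\<close>
  obtain u v w where u: "u \<in> A" "u \<in> V n" and v: "v \<in> B" "v \<in> W n" and w: "w \<in> A" "w \<in> V k"
    using \<open>n \<in> J\<close> \<open>k \<in> J\<close> unfolding J_def by blast
  have wU: "w \<in> U (Suc n)" using w VU[OF \<open>n < k\<close>] by auto
  from QD(7)[of n] obtain s t where s: "\<forall>x\<in>V n. \<forall>y\<in>W n. \<bar>f (x, y) - s\<bar> < e/4"
    and t: "\<forall>x\<in>U (Suc n). \<forall>y\<in>W n. \<bar>f (x, y) - t\<bar> < e/4" and st: "\<bar>s - t\<bar> \<ge> e"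
    by (elim exE conjE)
  \<comment> \<open>Four steps, each shorter than \<open>e/4\<close>: from \<open>s\<close> to
    \<open>f (u, v)\<close> to \<open>f (x, y)\<close> to \<open>f (w, v)\<close> to
    \<open>t\<close>.\<close>
  show False
    using bspec[OF bspec[OF s u(2)] v(2)] bspec[OF bspec[OF t wU] v(2)] st
      AB(5)[OF u(1) v(1)] AB(5)[OF w(1) v(1)] by linarith
qed

text \<open>This is total boundedness of the sup pseudometric on \<open>X\<close>. Otherwise there
  is an infinite \<open>e\<close>-separated sequence; equicontinuity surrounds its terms by open
  sets of radius \<open>e/4\<close>, and a cluster point of these brings two terms closer than
  \<open>e\<close>.\<close>

lemma pseudocompact_prod_finite_net:
  fixes f :: "'a \<times> 'b \<Rightarrow> real"
  assumes cr: "completely_regular_space (prod_topology X Y)"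
    and pc: "pseudocompact_space (prod_topology X Y)"
    and f: "continuous_map (prod_topology X Y) euclideanreal f" and e: "e > 0"
  obtains A where "finite A" "A \<subseteq> topspace X"
    "\<And>x. x \<in> topspace X \<Longrightarrow> \<exists>a\<in>A. \<forall>y\<in>topspace Y. \<bar>f (x, y) - f (a, y)\<bar> < e"
proof (rule ccontr)
  assume "\<not> thesis"
  with that have bad: "\<exists>x\<in>topspace X. \<forall>a\<in>A. \<exists>y\<in>topspace Y. e \<le> \<bar>f (x, y) - f (a, y)\<bar>"
    if "finite A" "A \<subseteq> topspace X" for A
    using that by (meson not_le)
  define P where "P = (\<lambda>(s :: nat \<Rightarrow> 'a) n x. x \<in> topspace X \<and>
      (\<forall>i<n. \<exists>y\<in>topspace Y. e \<le> \<bar>f (x, y) - f (s i, y)\<bar>))"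
  \<comment> \<open>Dependent choice: each term is picked at sup-distance at least \<open>e\<close>,
    witnessed by some \<open>y\<close>, from all earlier terms.\<close>
  have "\<exists>s. \<forall>n. P s n (s n)"
  proof (rule dependent_wellorder_choice)
    show "\<exists>x. P s n x" if "\<And>i. i < n \<Longrightarrow> P s i (s i)" for s n
      using bad[of "s ` {..<n}"] that unfolding P_def by blast
  qed (simp add: P_def)
  then obtain s :: "nat \<Rightarrow> 'a" where s: "\<And>n. s n \<in> topspace X"
    "\<And>i n. i < n \<Longrightarrow> \<exists>y\<in>topspace Y. e \<le> \<bar>f (s n, y) - f (s i, y)\<bar>"
    unfolding P_def by blast
  have e4: "e/4 > 0" using e by simp
  have "\<exists>U. openin X U \<and> a \<in> U \<and> (\<forall>x\<in>U. \<forall>y\<in>topspace Y. \<bar>f (x, y) - f (a, y)\<bar> < e/4)"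
    if "a \<in> topspace X" for a
    by (rule pseudocompact_prod_equicontinuous[OF cr pc f that e4]) blast
  then obtain U where U: "\<And>a. a \<in> topspace X \<Longrightarrow> openin X (U a)" "\<And>a. a \<in> topspace X \<Longrightarrow> a \<in> U a"
    "\<And>a x y. a \<in> topspace X \<Longrightarrow> x \<in> U a \<Longrightarrow> y \<in> topspace Y \<Longrightarrow> \<bar>f (x, y) - f (a, y)\<bar> < e/4"
    by metis
  have Y: "topspace Y \<noteq> {}" using s(2)[of 0 1] by auto
  \<comment> \<open>Full strips over \<open>Y\<close> turn open subsets of \<open>X\<close> into
    open subsets of the product, where pseudocompactness is available.\<close>
  have "openin (prod_topology X Y) (U (s n) \<times> topspace Y)" "U (s n) \<times> topspace Y \<noteq> {}" for n
    using U(1,2)[OF s(1)[of n]] Y by (auto simp: openin_prod_Times_iff)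
  note cl = pseudocompact_space_cluster_point[OF cr pc, of "\<lambda>n. U (s n) \<times> topspace Y", OF this]
  obtain z where z: "z \<in> topspace (prod_topology X Y)"
    "\<And>A. openin (prod_topology X Y) A \<Longrightarrow> z \<in> A \<Longrightarrow> infinite {n. (U (s n) \<times> topspace Y) \<inter> A \<noteq> {}}"
    by (rule cl) blast
  obtain x where x: "x \<in> topspace X" "x = fst z" "snd z \<in> topspace Y" using z(1) by auto
  define J where "J = {n. (U (s n) \<times> topspace Y) \<inter> (U x \<times> topspace Y) \<noteq> {}}"
  have "infinite J"
    unfolding J_def by (rule z(2)) (use U(1,2)[OF x(1)] x(2,3) in \<open>simp_all add: openin_prod_Times_iff mem_Times_iff\<close>)
  then obtain n where "n \<in> J" by (metis ex_in_conv finite.emptyI)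
  obtain k where "k \<in> J" "n < k" using \<open>infinite J\<close> infinite_nat_iff_unbounded by blast
  obtain u w where u: "u \<in> U (s n)" "u \<in> U x" and w: "w \<in> U (s k)" "w \<in> U x"
    using \<open>n \<in> J\<close> \<open>k \<in> J\<close> unfolding J_def by blast
  obtain y where y: "y \<in> topspace Y" "e \<le> \<bar>f (s k, y) - f (s n, y)\<bar>"
    using s(2)[OF \<open>n < k\<close>] by blast
  \<comment> \<open>The chain \<open>s n\<close>, \<open>u\<close>, \<open>x\<close>,
    \<open>w\<close>, \<open>s k\<close> has four links shorter than \<open>e/4\<close>, evaluated
    at the separating \<open>y\<close>.\<close>
  show False
    using U(3)[OF s(1) u(1) y(1)] U(3)[OF x(1) u(2) y(1)] U(3)[OF s(1) w(1) y(1)]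
      U(3)[OF x(1) w(2) y(1)] y(2) by linarith
qed

section \<open>Uniform continuity on a pseudocompact product\<close>

lemma continuous_map_realI:
  fixes f :: "'a \<Rightarrow> real"
  assumes "\<And>a e. a \<in> topspace X \<Longrightarrow> e > 0 \<Longrightarrow> \<exists>U. openin X U \<and> a \<in> U \<and> (\<forall>x\<in>U. \<bar>f x - f a\<bar> < e)"
  shows "continuous_map X euclideanreal f"
  using assms unfolding Met_TC.continuous_map_to_metric[unfolded mtopology_is_euclidean]
  by (simp add: dist_real_def abs_minus_commute)

text \<open>These functions generate the uniformity on \<open>X\<close>. Their values off
  \<open>topspace X\<close> are arbitrary, so they are restricted before serving as coordinates of
  the cube below.\<close>

definition unit_functions :: "'a topology \<Rightarrow> ('a \<Rightarrow> real) set" where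
  "unit_functions X = {g. continuous_map X (top_of_set {0..1}) g}"

lemma unit_functions_iff:
  "g \<in> unit_functions X \<longleftrightarrow> continuous_map X euclideanreal g \<and> (\<forall>x\<in>topspace X. g x \<in> {0..1})"
  by (auto simp: unit_functions_def continuous_map_in_subtopology)

lemma continuous_map_op:
  assumes "continuous_map (prod_topology X X) X (\<lambda>(x, y). m x y)"
    and "continuous_map T X a" "continuous_map T X b"
  shows "continuous_map T X (\<lambda>t. m (a t) (b t))"
  using continuous_map_compose[OF continuous_map_pairedI[OF assms(2,3)] assms(1)]
  by (simp add: o_def)

lemma embedding_map_imp_continuous_map:
  assumes "embedding_map X Y f"
  shows "continuous_map X Y f"
  using homeomorphic_imp_continuous_map[OF assms[unfolded embedding_map_def]]
  by (simp add: continuous_map_in_subtopology)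

text \<open>With a finite net \<open>A\<close>, let \<open>P\<close> consist of the sup-distances to
  the net points and \<open>Q\<close> of the slices of \<open>f\<close> at the net points. Moving
  from \<open>(x, y)\<close> via \<open>(a, y)\<close> and \<open>(a, y')\<close> to
  \<open>(x', y')\<close> costs at most \<open>e\<close>, \<open>e\<close> and \<open>2 * e\<close>,
  with strict inequality.\<close>

lemma pseudocompact_prod_uniform:
  fixes f :: "'a \<times> 'b \<Rightarrow> real"
  assumes cr: "completely_regular_space (prod_topology X Y)"
    and pc: "pseudocompact_space (prod_topology X Y)"
    and f: "f \<in> unit_functions (prod_topology X Y)" and e: "e > 0"
  obtains P Q where "finite P" "P \<subseteq> unit_functions X" "finite Q" "Q \<subseteq> unit_functions Y"
    "\<And>x x' y y'. x \<in> topspace X \<Longrightarrow> x' \<in> topspace X \<Longrightarrow> y \<in> topspace Y \<Longrightarrow> y' \<in> topspace Y \<Longrightarrow>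
      (\<And>g. g \<in> P \<Longrightarrow> \<bar>g x - g x'\<bar> < e) \<Longrightarrow> (\<And>h. h \<in> Q \<Longrightarrow> \<bar>h y - h y'\<bar> < e) \<Longrightarrow>
      \<bar>f (x, y) - f (x', y')\<bar> < 4 * e"
proof (cases "topspace Y = {}")
  case True
  \<comment> \<open>The estimate is vacuous without points \<open>y\<close>. In the other case the
    suprema below range over a nonempty set.\<close>
  show ?thesis by (rule that[of "{}" "{}"]) (use True in simp_all)
next
  case Y: False
  have fc: "continuous_map (prod_topology X Y) euclideanreal f"
    using f by (simp add: unit_functions_iff)
  have f01: "f (x, y) \<in> {0..1}" if "x \<in> topspace X" "y \<in> topspace Y" for x y
    using f that unfolding unit_functions_iff by (metis SigmaI topspace_prod_topology)
  obtain A where A: "finite A" "A \<subseteq> topspace X"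
    "\<And>x. x \<in> topspace X \<Longrightarrow> \<exists>a\<in>A. \<forall>y\<in>topspace Y. \<bar>f (x, y) - f (a, y)\<bar> < e"
    by (rule pseudocompact_prod_finite_net[OF cr pc fc e]) blast
  define d where "d a x = (SUP y\<in>topspace Y. \<bar>f (x, y) - f (a, y)\<bar>)" for a x
  have diff1: "\<bar>f (x, y) - f (a, y)\<bar> \<le> 1" if "x \<in> topspace X" "a \<in> topspace X" "y \<in> topspace Y" for x a y
    using f01[OF that(1,3)] f01[OF that(2,3)] by auto
  have d_upper: "\<bar>f (x, y) - f (a, y)\<bar> \<le> d a x"
    if "x \<in> topspace X" "a \<in> topspace X" "y \<in> topspace Y" for x a y
    unfolding d_def by (rule cSUP_upper) (use that diff1 in \<open>auto intro!: bdd_aboveI2[where M=1]\<close>)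
  have d_least: "d a x \<le> c" if "\<And>y. y \<in> topspace Y \<Longrightarrow> \<bar>f (x, y) - f (a, y)\<bar> \<le> c" for a x c
    unfolding d_def by (rule cSUP_least) (use that Y in auto)
  have d_unit: "d a \<in> unit_functions X" if a: "a \<in> topspace X" for a
    unfolding unit_functions_iff
  proof (intro conjI ballI)
    show "d a x \<in> {0..1}" if x: "x \<in> topspace X" for x
    proof -
      obtain y where "y \<in> topspace Y" using Y by blast
      from d_upper[OF x a this] have "0 \<le> d a x" by linarith
      then show ?thesis using d_least[of x a 1] diff1[OF x a] by simp
    qed
    show "continuous_map X euclideanreal (d a)"
    proof (rule continuous_map_realI)
      fix x0 and \<epsilon> :: real assume x0: "x0 \<in> topspace X" and \<epsilon>: "\<epsilon> > 0"
      have "\<epsilon>/2 > 0" using \<epsilon> by simp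
      obtain U where U: "openin X U" "x0 \<in> U"
        "\<And>x y. x \<in> U \<Longrightarrow> y \<in> topspace Y \<Longrightarrow> \<bar>f (x, y) - f (x0, y)\<bar> < \<epsilon>/2"
        by (rule pseudocompact_prod_equicontinuous[OF cr pc fc x0 \<open>\<epsilon>/2 > 0\<close>]) blast
      have "\<bar>d a x - d a x0\<bar> < \<epsilon>" if "x \<in> U" for x
      \<comment> \<open>Over \<open>U\<close> every difference under the supremum changes by less
        than \<open>\<epsilon>/2\<close>, hence the supremum by at most
        \<open>\<epsilon>/2\<close>.\<close>
      proof -
        have x: "x \<in> topspace X" using that U(1) openin_subset by blast
        have "d a x \<le> d a x0 + \<epsilon>/2"
          by (rule d_least) (use U(3)[OF that] d_upper[OF x0 a] in \<open>smt (verit)\<close>)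
        moreover have "d a x0 \<le> d a x + \<epsilon>/2"
          by (rule d_least) (use U(3)[OF that] d_upper[OF x a] in \<open>smt (verit)\<close>)
        ultimately show ?thesis using \<epsilon> by linarith
      qed
      with U(1,2) show "\<exists>U. openin X U \<and> x0 \<in> U \<and> (\<forall>x\<in>U. \<bar>d a x - d a x0\<bar> < \<epsilon>)" by blast
    qed
  qed
  have slice: "(\<lambda>y. f (a, y)) \<in> unit_functions Y" if "a \<in> topspace X" for a
  proof -
    have "continuous_map Y (prod_topology X Y) (\<lambda>y. (a, y))"
      using that by (intro continuous_map_pairedI) auto
    from continuous_map_compose[OF this fc] show ?thesis
      using f01 that by (auto simp: unit_functions_iff o_def)
  qed
  show ?thesis
  proof (rule that[of "d ` A" "(\<lambda>a y. f (a, y)) ` A"])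
    fix x x' y y'
    assume x: "x \<in> topspace X" and x': "x' \<in> topspace X" and y: "y \<in> topspace Y" and y': "y' \<in> topspace Y"
      and P: "\<And>g. g \<in> d ` A \<Longrightarrow> \<bar>g x - g x'\<bar> < e"
      and Q: "\<And>h. h \<in> (\<lambda>a y. f (a, y)) ` A \<Longrightarrow> \<bar>h y - h y'\<bar> < e"
    obtain a where a: "a \<in> A" "\<And>y. y \<in> topspace Y \<Longrightarrow> \<bar>f (x, y) - f (a, y)\<bar> < e"
      using A(3)[OF x] by blast
    have aX: "a \<in> topspace X" using a A by blast
    \<comment> \<open>As \<open>x\<close> is within \<open>e\<close> of the net point
      \<open>a\<close>, closeness of \<open>d a x\<close> and \<open>d a x'\<close> puts
      \<open>x'\<close> within \<open>2 * e\<close> of \<open>a\<close>, uniformly in the second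
      argument.\<close>
    have "d a x \<le> e" using a(2) by (intro d_least) (simp add: less_imp_le)
    moreover have "\<bar>d a x - d a x'\<bar> < e" using P a(1) by blast
    moreover have "\<bar>f (a, y) - f (a, y')\<bar> < e" using Q[of "\<lambda>y. f (a, y)"] a(1) by blast
    ultimately show "\<bar>f (x, y) - f (x', y')\<bar> < 4 * e"
      using a(2)[OF y] d_upper[OF x' aX y'] by linarith
  qed (use A d_unit slice in auto)
qed

subsection \<open>The compactification\<close>

text \<open>Vanishing oscillation gives continuity at points of \<open>S\<close>. At other points it
  makes \<open>\<phi>\<close> Cauchy along the trace of the neighbourhood filter, so a limit exists
  by completeness of the reals; regularity of the reals makes the pointwise limits a continuous
  extension.\<close>

lemma continuous_map_real_extension:
  fixes \<phi> :: "'a \<Rightarrow> real"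
  assumes S: "S \<subseteq> topspace Z" "topspace Z \<subseteq> Abstract_Topology.closure_of Z S"
    and osc: "\<And>z e. z \<in> topspace Z \<Longrightarrow> e > 0 \<Longrightarrow>
      \<exists>W. openin Z W \<and> z \<in> W \<and> (\<forall>s\<in>S \<inter> W. \<forall>t\<in>S \<inter> W. \<bar>\<phi> s - \<phi> t\<bar> < e)"
  obtains \<psi> where "continuous_map Z euclideanreal \<psi>" "\<And>s. s \<in> S \<Longrightarrow> \<psi> s = \<phi> s"
proof -
  have "continuous_map (subtopology Z S) euclideanreal \<phi>"
  proof (rule continuous_map_realI)
    fix a and e :: real assume a: "a \<in> topspace (subtopology Z S)" and e: "e > 0"
    then have "a \<in> topspace Z" by simp
    from osc[OF this e] obtain W where W: "openin Z W" "a \<in> W"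
      "\<forall>s\<in>S \<inter> W. \<forall>t\<in>S \<inter> W. \<bar>\<phi> s - \<phi> t\<bar> < e" by blast
    have "openin (subtopology Z S) (S \<inter> W)" using W(1) by (auto simp: openin_subtopology)
    moreover have "a \<in> S \<inter> W" using a W(2) by simp
    ultimately show "\<exists>U. openin (subtopology Z S) U \<and> a \<in> U \<and> (\<forall>x\<in>U. \<bar>\<phi> x - \<phi> a\<bar> < e)"
      using W(3) by blast
  qed
  moreover have "\<exists>l. limitin euclideanreal \<phi> l (atin_within Z t S)" if t: "t \<in> topspace Z - S" for t
  proof (cases "atin_within Z t S = bot")
    case True
    \<comment> \<open>Along the trivial filter every real is a limit.\<close>
    then show ?thesis by (simp add: limitin_def)
  next
    case False
    have "cauchy_filter (filtermap \<phi> (atin_within Z t S))"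
      unfolding cauchy_filter_metric_filtermap
    proof (intro allI impI)
      fix e :: real assume "e > 0"
      with osc[of t e] t obtain W where W: "openin Z W" "t \<in> W"
        "\<forall>s\<in>S \<inter> W. \<forall>t\<in>S \<inter> W. \<bar>\<phi> s - \<phi> t\<bar> < e"
        by blast
      have "eventually (\<lambda>x. x \<in> S \<inter> W) (atin_within Z t S)"
        using W(1,2) unfolding eventually_atin_within by blast
      then show "\<exists>P. eventually P (atin_within Z t S) \<and> (\<forall>x y. P x \<and> P y \<longrightarrow> dist (\<phi> x) (\<phi> y) < e)"
        using W(3) unfolding dist_real_def by blast
    qed
    moreover have "filtermap \<phi> (atin_within Z t S) \<noteq> bot" using False by (simp add: filtermap_bot_iff)
    ultimately have "\<exists>l. filtermap \<phi> (atin_within Z t S) \<le> nhds l"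
      using complete_UNIV[where ?'a = real] unfolding complete_uniform by auto
    then show ?thesis by (simp add: filterlim_def)
  qed
  ultimately show ?thesis
    using continuous_map_extension_pointwise_alt[OF _ S(1,2), of euclideanreal \<phi>] that
      regular_space_euclidean by (metis subtopology_topspace)
qed

lemma prod_unit_function:
  assumes "continuous_map (prod_topology X X) X (\<lambda>(x, y). m x y)" "g \<in> unit_functions X"
  shows "(\<lambda>(x, y). g (m x y)) \<in> unit_functions (prod_topology X X)"
  using continuous_map_compose[OF assms(1), of "top_of_set {0..1}" g] assms(2)
  by (simp add: unit_functions_def o_def case_prod_unfold)

text \<open>\<open>K\<close> is the closure of \<open>X\<close> in a cube, whose points are
  functions on a set of real functions; hence its type. The product is built coordinatewise: the
  coordinate \<open>g\<close> of \<open>n p q\<close> is the extension to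
  \<open>K \<times> K\<close> of the map sending \<open>(x, y)\<close> to
  \<open>g (m x y)\<close>.\<close>

lemma pseudocompact_square_semigroup_compactification:
  fixes X :: "'a topology"
  assumes sg: "topological_semigroup X m" and ty: "tychonoff_space X"
    and pc: "pseudocompact_space (prod_topology X X)"
  obtains K :: "(('a \<Rightarrow> real) \<Rightarrow> real) topology" and n h
  where "topological_semigroup K n" "compact_space K" "semigroup_embedding X m K n h"
proof -
  have mc: "continuous_map (prod_topology X X) X (\<lambda>(x, y). m x y)"
    and as: "\<And>x y z. x \<in> topspace X \<Longrightarrow> y \<in> topspace X \<Longrightarrow> z \<in> topspace X \<Longrightarrow> m (m x y) z = m x (m y z)"
    using sg by (auto simp: topological_semigroup_def)
  have mX: "m x y \<in> topspace X" if "x \<in> topspace X" "y \<in> topspace X" for x y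
    using continuous_map_image_subset_topspace[OF mc] that by auto
  have crX: "completely_regular_space X" and HX: "Hausdorff_space X"
    using ty by (auto simp: tychonoff_space_def)
  have cr: "completely_regular_space (prod_topology X X)"
    using crX by (simp add: completely_regular_space_prod_topology)
  \<comment> \<open>The coordinates are the continuous functions into the unit interval, made
    extensional on \<open>topspace X\<close>.\<close>
  define I where "I = mspace (submetric (cfunspace X euclidean_metric) {f. f \<in> topspace X \<rightarrow> {0..1::real}})"
  define P where "P = product_topology (\<lambda>f. top_of_set {0..1::real}) I"
  define h where "h x = (\<lambda>g\<in>I. g x)" for x :: 'a
  have embP: "embedding_map X P h"
    using completely_regular_space_cube_embedding_explicit[OF crX HX]
    unfolding P_def I_def h_def .
  have hg: "h x g = g x" if "g \<in> I" for x g
    using that by (simp add: h_def)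
  have I_unit: "g \<in> unit_functions X" if "g \<in> I" for g
    using that by (auto simp: I_def unit_functions_iff)
  have unit_I: "restrict g (topspace X) \<in> I" if "g \<in> unit_functions X" for g
  proof -
    have "g ` topspace X \<subseteq> {0..1}" using that by (auto simp: unit_functions_iff)
    then have "bounded (g ` topspace X)" by (metis bounded_closed_interval bounded_subset)
    with that show ?thesis by (auto simp: I_def unit_functions_iff)
  qed
  define D where "D = h ` topspace X"
  define K where "K = subtopology P (Abstract_Topology.closure_of P D)"
  have DP: "D \<subseteq> topspace P"
    using continuous_map_image_subset_topspace[OF embedding_map_imp_continuous_map[OF embP]]
    by (simp add: D_def)
  have topK: "topspace K = Abstract_Topology.closure_of P D"
    by (simp add: K_def closure_of_subset_topspace inf.absorb2)
  have DK: "D \<subseteq> topspace K" unfolding topK by (rule closure_of_subset[OF DP])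
  have dense: "Abstract_Topology.closure_of K D = topspace K"
    using DK unfolding topK by (simp add: K_def closure_of_subtopology inf.absorb2)
  have "compact_space P"
    by (simp add: P_def compact_space_product_topology compact_space_subtopology)
  then have compK: "compact_space K"
    unfolding K_def by (intro compact_space_subtopology closedin_compact_space closedin_closure_of)
  have "Hausdorff_space P"
    by (simp add: P_def Hausdorff_space_product_topology Hausdorff_space_subtopology)
  then have HK: "Hausdorff_space K" by (simp add: K_def Hausdorff_space_subtopology)
  have embK: "embedding_map X K h"
    unfolding K_def embedding_map_in_subtopology using embP closure_of_subset[OF DP] D_def by simp
  have hX: "h x \<in> topspace K" if "x \<in> topspace X" for x
    using DK that by (auto simp: D_def)
  have "inj_on h (topspace X)"
    using embK by (simp add: embedding_map_def homeomorphic_eq_everything_map)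
  \<comment> \<open>The left inverse \<open>k\<close> lets a function on \<open>X\<close> be read as
    a function on the dense set \<open>D\<close>.\<close>
  then obtain k where k: "\<And>x. x \<in> topspace X \<Longrightarrow> k (h x) = x"
    by (metis inv_into_f_f)
  have proj: "continuous_map K euclideanreal (\<lambda>p. p g)" if "g \<in> I" for g
  proof -
    have "continuous_map P (top_of_set {0..1}) (\<lambda>p. p g)"
      unfolding P_def using that by (rule continuous_map_product_projection)
    then show ?thesis
      unfolding K_def continuous_map_in_subtopology by (blast intro: continuous_map_from_subtopology)
  qed
  \<comment> \<open>The uniformity generated by the unit functions is the one induced from
    \<open>K\<close>: finitely many of them have small oscillation on the trace of a neighbourhood
    of \<open>p\<close>, because each is a coordinate on \<open>K\<close>.\<close>
  have nbhd: "\<exists>U. openin K U \<and> p \<in> U \<and>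
      (\<forall>x\<in>topspace X. \<forall>x'\<in>topspace X. h x \<in> U \<longrightarrow> h x' \<in> U \<longrightarrow> (\<forall>u\<in>F. \<bar>u x - u x'\<bar> < d))"
    if "finite F" "F \<subseteq> unit_functions X" "p \<in> topspace K" "d > 0" for F p d
    using that
  proof (induction F)
    case empty
    then show ?case by (intro exI[of _ "topspace K"]) simp
  next
    case (insert v F)
    then obtain U where U: "openin K U" "p \<in> U"
      "\<And>x x' u. x \<in> topspace X \<Longrightarrow> x' \<in> topspace X \<Longrightarrow> h x \<in> U \<Longrightarrow> h x' \<in> U \<Longrightarrow> u \<in> F \<Longrightarrow> \<bar>u x - u x'\<bar> < d"
      by blast
    define v' where "v' = restrict v (topspace X)"
    have v': "v' \<in> I" using insert.prems unit_I by (simp add: v'_def)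
    have "d/2 > 0" using insert.prems by simp
    obtain V where V: "openin K V" "p \<in> V" "\<And>q. q \<in> V \<Longrightarrow> \<bar>q v' - p v'\<bar> < d/2"
      by (rule continuous_map_real_nbhd[OF proj[OF v'] \<open>p \<in> topspace K\<close> \<open>d/2 > 0\<close>]) blast
    have "\<bar>v x - v x'\<bar> < d" if "x \<in> topspace X" "x' \<in> topspace X" "h x \<in> V" "h x' \<in> V" for x x'
    proof -
      have "h x v' = v x" "h x' v' = v x'" using that v' by (simp_all add: hg) (simp_all add: v'_def)
      then show ?thesis using V(3)[OF that(3)] V(3)[OF that(4)] by linarith
    qed
    with U V show ?case by (intro exI[of _ "U \<inter> V"]) blast
  qed
  define Z where "Z = prod_topology K K"
  have denseZ: "D \<times> D \<subseteq> topspace Z" "topspace Z \<subseteq> Abstract_Topology.closure_of Z (D \<times> D)"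
    using DK dense by (auto simp: Z_def closure_of_Times)
  have "\<exists>\<psi>. continuous_map Z euclideanreal \<psi> \<and> (\<forall>x\<in>topspace X. \<forall>y\<in>topspace X. \<psi> (h x, h y) = g (m x y))"
    if g: "g \<in> I" for g
  proof -
    define \<phi> where "\<phi> = (\<lambda>(p, q). g (m (k p) (k q)))"
    have osc: "\<exists>W. openin Z W \<and> z \<in> W \<and> (\<forall>s\<in>(D \<times> D) \<inter> W. \<forall>t\<in>(D \<times> D) \<inter> W. \<bar>\<phi> s - \<phi> t\<bar> < e)"
      if z: "z \<in> topspace Z" and e: "e > 0" for z and e :: real
    proof -
      obtain p q where pq: "z = (p, q)" "p \<in> topspace K" "q \<in> topspace K"
        using z by (auto simp: Z_def)
      have e4: "e/4 > 0" using e by simp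
      \<comment> \<open>The value \<open>e/4\<close> compensates the factor 4 in the uniform
        estimate.\<close>
      obtain F G where F: "finite F" "F \<subseteq> unit_functions X" and G: "finite G" "G \<subseteq> unit_functions X"
        and FG: "\<And>x x' y y'. x \<in> topspace X \<Longrightarrow> x' \<in> topspace X \<Longrightarrow> y \<in> topspace X \<Longrightarrow> y' \<in> topspace X \<Longrightarrow>
          (\<And>u. u \<in> F \<Longrightarrow> \<bar>u x - u x'\<bar> < e/4) \<Longrightarrow> (\<And>v. v \<in> G \<Longrightarrow> \<bar>v y - v y'\<bar> < e/4) \<Longrightarrow>
          \<bar>(\<lambda>(x, y). g (m x y)) (x, y) - (\<lambda>(x, y). g (m x y)) (x', y')\<bar> < 4 * (e/4)"
        by (rule pseudocompact_prod_uniform[OF cr pc prod_unit_function[OF mc I_unit[OF g]] e4]) blast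
      obtain U where U: "openin K U" "p \<in> U"
        "\<And>x x' u. x \<in> topspace X \<Longrightarrow> x' \<in> topspace X \<Longrightarrow> h x \<in> U \<Longrightarrow> h x' \<in> U \<Longrightarrow> u \<in> F \<Longrightarrow> \<bar>u x - u x'\<bar> < e/4"
        using nbhd[OF F pq(2) e4] by blast
      obtain V where V: "openin K V" "q \<in> V"
        "\<And>x x' u. x \<in> topspace X \<Longrightarrow> x' \<in> topspace X \<Longrightarrow> h x \<in> V \<Longrightarrow> h x' \<in> V \<Longrightarrow> u \<in> G \<Longrightarrow> \<bar>u x - u x'\<bar> < e/4"
        using nbhd[OF G pq(3) e4] by blast
      have "\<bar>\<phi> s - \<phi> t\<bar> < e" if st: "s \<in> (D \<times> D) \<inter> U \<times> V" "t \<in> (D \<times> D) \<inter> U \<times> V" for s t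
      proof -
        obtain x y x' y' where s: "s = (h x, h y)" "t = (h x', h y')"
          and X: "x \<in> topspace X" "y \<in> topspace X" "x' \<in> topspace X" "y' \<in> topspace X"
          using st by (auto simp: D_def)
        have UV: "h x \<in> U" "h x' \<in> U" "h y \<in> V" "h y' \<in> V" using st s by auto
        have "\<bar>g (m x y) - g (m x' y')\<bar> < 4 * (e/4)"
          using FG[OF X(1,3,2,4) U(3)[OF X(1,3) UV(1,2)] V(3)[OF X(2,4) UV(3,4)]] by simp
        then show ?thesis using X by (simp add: s \<phi>_def k)
      qed
      moreover have "openin Z (U \<times> V)" "z \<in> U \<times> V"
        using U V by (simp_all add: Z_def openin_prod_Times_iff pq)
      ultimately show ?thesis by blast
    qed
    obtain \<psi> where \<psi>: "continuous_map Z euclideanreal \<psi>" "\<And>s. s \<in> D \<times> D \<Longrightarrow> \<psi> s = \<phi> s"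
      using continuous_map_real_extension[OF denseZ osc] by blast
    have "\<psi> (h x, h y) = g (m x y)" if "x \<in> topspace X" "y \<in> topspace X" for x y
      using \<psi>(2)[of "(h x, h y)"] that by (simp add: D_def \<phi>_def k)
    with \<psi>(1) show ?thesis by blast
  qed
  then obtain \<psi> where \<psi>c: "\<And>g. g \<in> I \<Longrightarrow> continuous_map Z euclideanreal (\<psi> g)"
    and \<psi>h: "\<And>g x y. g \<in> I \<Longrightarrow> x \<in> topspace X \<Longrightarrow> y \<in> topspace X \<Longrightarrow> \<psi> g (h x, h y) = g (m x y)"
    by metis
  have \<psi>01: "\<psi> g z \<in> {0..1}" if g: "g \<in> I" and z: "z \<in> topspace Z" for g z
  proof -
    \<comment> \<open>The bounds hold on the dense set \<open>D \<times> D\<close> and are a closed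
      condition. They are needed for \<open>n p q\<close> to lie in the cube.\<close>
    have "closedin Z {z \<in> topspace Z. \<psi> g z \<in> {0..1}}"
      by (rule closedin_continuous_map_preimage[OF \<psi>c[OF g]]) simp
    moreover have "\<psi> g s \<in> {0..1}" if "s \<in> D \<times> D" for s
      using that \<psi>h[OF g] I_unit[OF g] mX by (auto simp: D_def unit_functions_iff)
    ultimately show ?thesis
      using closure_of_minimal[of "D \<times> D" "{z \<in> topspace Z. \<psi> g z \<in> {0..1}}" Z] denseZ z by blast
  qed
  define n where "n p q = (\<lambda>g\<in>I. \<psi> g (p, q))" for p q
  have nh: "n (h x) (h y) = h (m x y)" if "x \<in> topspace X" "y \<in> topspace X" for x y
    using \<psi>h that by (auto simp: n_def h_def)
  define N where "N = (\<lambda>(p, q). n p q)"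
  have NP: "continuous_map Z P N"
    unfolding P_def continuous_map_componentwise
  proof (intro conjI ballI)
    show "N ` topspace Z \<subseteq> extensional I" by (auto simp: N_def n_def)
    show "continuous_map Z (top_of_set {0..1}) (\<lambda>z. N z g)" if "g \<in> I" for g
    proof (rule continuous_map_into_subtopology)
      show "continuous_map Z euclideanreal (\<lambda>z. N z g)"
        using \<psi>c[OF that] that by (simp add: N_def n_def case_prod_unfold)
      show "(\<lambda>z. N z g) \<in> topspace Z \<rightarrow> {0..1}"
        using \<psi>01[OF that] that by (auto simp: N_def n_def)
    qed
  qed
  \<comment> \<open>Since \<open>h\<close> is multiplicative, products of points of \<open>D\<close>
    stay in \<open>D\<close>; continuity then sends \<open>K \<times> K\<close> into the closure of
    \<open>D\<close>, which is \<open>K\<close>.\<close>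
  have "N ` (D \<times> D) \<subseteq> D"
    using nh mX by (auto simp: N_def D_def)
  then have "N ` topspace Z \<subseteq> Abstract_Topology.closure_of P D"
    using continuous_map_image_closure_subset[OF NP, of "D \<times> D"] denseZ(2) closure_of_mono[of "N ` (D \<times> D)" D P]
    by blast
  then have NK: "continuous_map (prod_topology K K) K (\<lambda>(p, q). n p q)"
    using NP unfolding K_def[symmetric] N_def[symmetric] Z_def[symmetric]
    by (simp add: K_def continuous_map_in_subtopology image_subset_iff_funcset)
  have "n (n p q) r = n p (n q r)" if "p \<in> topspace K" "q \<in> topspace K" "r \<in> topspace K" for p q r
  proof -
    define T where "T = prod_topology K (prod_topology K K)"
    \<comment> \<open>Both bracketings are continuous maps into a Hausdorff space and agree on the
      dense set of triples from \<open>D\<close>.\<close>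
    have pqr: "(p, q, r) \<in> Abstract_Topology.closure_of T (D \<times> D \<times> D)"
      using that by (simp add: T_def closure_of_Times dense)
    have c: "continuous_map T K fst" "continuous_map T K (\<lambda>t. fst (snd t))" "continuous_map T K (\<lambda>t. snd (snd t))"
      unfolding T_def using continuous_map_compose[OF continuous_map_snd continuous_map_fst]
        continuous_map_compose[OF continuous_map_snd continuous_map_snd]
      by (auto simp: o_def continuous_map_fst)
    have "n (n (fst t) (fst (snd t))) (snd (snd t)) = n (fst t) (n (fst (snd t)) (snd (snd t)))"
      if "t \<in> D \<times> D \<times> D" for t
      using that by (auto simp: D_def nh mX as)
    from forall_in_closure_of_eq[OF pqr HK continuous_map_op[OF NK continuous_map_op[OF NK c(1,2)] c(3)]
        continuous_map_op[OF NK c(1) continuous_map_op[OF NK c(2,3)]] this]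
    show ?thesis by simp
  qed
  then have "topological_semigroup K n"
    using HK NK by (simp add: topological_semigroup_def)
  moreover have "semigroup_embedding X m K n h"
    using embK nh by (simp add: semigroup_embedding_def)
  ultimately show ?thesis using that compK by blast
qed

subsection \<open>Inversion and maximal subgroups\<close>

lemma continuous_map_into_embedding:
  assumes h: "embedding_map Y Z h" and f: "f \<in> topspace X \<rightarrow> topspace Y"
    and hf: "continuous_map X Z (\<lambda>x. h (f x))"
  shows "continuous_map X Y f"
proof -
  obtain k where "homeomorphic_maps Y (subtopology Z (h ` topspace Y)) h k"
    using h by (auto simp: embedding_map_def homeomorphic_map_maps)
  then have k: "continuous_map (subtopology Z (h ` topspace Y)) Y k" "\<And>y. y \<in> topspace Y \<Longrightarrow> k (h y) = y"
    by (auto simp: homeomorphic_maps_def)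
  have "continuous_map X (subtopology Z (h ` topspace Y)) (\<lambda>x. h (f x))"
    using hf f by (intro continuous_map_into_subtopology) auto
  from continuous_map_compose[OF this k(1)] show ?thesis
    by (rule continuous_map_eq) (use k(2) f in auto)
qed

lemma embedding_map_openin:
  assumes h: "embedding_map X K h" and W: "openin X W"
  obtains W' where "openin K W'" "\<And>x. x \<in> topspace X \<Longrightarrow> h x \<in> W' \<longleftrightarrow> x \<in> W"
proof -
  have hm: "homeomorphic_map X (subtopology K (h ` topspace X)) h"
    using h by (simp add: embedding_map_def)
  then have "openin (subtopology K (h ` topspace X)) (h ` W)"
    using W openin_subset[OF W] by (simp add: homeomorphic_map_openness)
  then obtain W' where W': "openin K W'" "h ` W = W' \<inter> h ` topspace X"
    by (auto simp: openin_subtopology)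
  have "inj_on h (topspace X)" using hm by (simp add: homeomorphic_eq_everything_map)
  then have "h x \<in> W' \<longleftrightarrow> x \<in> W" if "x \<in> topspace X" for x
    using W'(2) that openin_subset[OF W] by (metis IntD1 IntI image_eqI inj_on_image_mem_iff)
  with W'(1) show ?thesis by (rule that)
qed

text \<open>Purely equational and free of any named idempotent: the identity of the group is
  \<open>m x y\<close>. Therefore the relation is closed in a Hausdorff semigroup and is preserved
  by homomorphisms.\<close>

definition group_inverse :: "('a \<Rightarrow> 'a \<Rightarrow> 'a) \<Rightarrow> 'a \<Rightarrow> 'a \<Rightarrow> bool" where
  "group_inverse m x y \<longleftrightarrow> m (m x y) x = x \<and> m (m y x) y = y \<and> m x y = m y x"

lemma topological_semigroup_closed:
  assumes "topological_semigroup X m" "x \<in> topspace X" "y \<in> topspace X"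
  shows "m x y \<in> topspace X"
proof -
  have "continuous_map (prod_topology X X) X (\<lambda>(x, y). m x y)"
    using assms(1) by (simp add: topological_semigroup_def)
  from continuous_map_image_subset_topspace[OF this] show ?thesis using assms(2,3) by auto
qed

lemma topological_semigroup_assoc:
  assumes "topological_semigroup X m" "x \<in> topspace X" "y \<in> topspace X" "z \<in> topspace X"
  shows "m (m x y) z = m x (m y z)"
  using assms by (simp add: topological_semigroup_def)

text \<open>The idempotents \<open>m x y\<close> and \<open>m x z\<close> absorb each other and
  hence coincide. With \<open>e\<close> this common idempotent,
  \<open>y = e y = z x y = z e = z\<close>.\<close>

lemma group_inverse_unique:
  assumes S: "topological_semigroup X m" and X: "x \<in> topspace X" "y \<in> topspace X" "z \<in> topspace X"
    and y: "group_inverse m x y" and z: "group_inverse m x z"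
  shows "y = z"
proof -
  note cl = topological_semigroup_closed[OF S] and as = topological_semigroup_assoc[OF S]
  have y': "m (m x y) x = x" "m (m y x) y = y" "m x y = m y x"
    and z': "m (m x z) x = x" "m (m z x) z = z" "m x z = m z x"
    using y z by (auto simp: group_inverse_def)
  have "m x y = m (m x z) (m x y)"
    using as[of "m x z" x y] X z'(1) by (simp add: cl)
  moreover have "m z x = m (m z x) (m y x)"
    using as[of "m z x" y x] as[of z x "m y x"] as[of x y x] X y'(1) by (simp add: cl)
  ultimately have e: "m x y = m x z" using y'(3) z'(3) by metis
  have "y = m (m z x) y" using y' z' e by metis
  also have "\<dots> = m z (m x y)" using X by (rule_tac as) auto
  also have "\<dots> = m (m z x) z" using e X as[of z x z] by simp
  finally show ?thesis using z' by simp
qed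

section \<open>Inversion on the union of the maximal subgroups\<close>

lemma idempotents_topspace: "e \<in> idempotents X m \<Longrightarrow> e \<in> topspace X"
  by (simp add: idempotents_def)

lemma group_maximal_group:
  assumes "topological_semigroup X m" "e \<in> idempotents X m"
  shows "Group.group (maximal_group X m e)"
  using maximal_subgroup_greatest(1)[OF assms] by (simp add: subgroup_at_def maximal_group_def)

lemma maximal_subgroup_subset:
  assumes "topological_semigroup X m" "e \<in> idempotents X m"
  shows "maximal_subgroup X m e \<subseteq> topspace X"
  using maximal_subgroup_greatest(1)[OF assms] by (simp add: subgroup_at_def)

lemma inversion_eq_inv:
  assumes S: "topological_semigroup X m" and e: "e \<in> idempotents X m" and x: "x \<in> maximal_subgroup X m e"
  shows "inversion X m x = inv\<^bsub>maximal_group X m e\<^esub> x"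
proof -
  have "(THE e. e \<in> idempotents X m \<and> x \<in> maximal_subgroup X m e) = e"
    using e x maximal_subgroup_unique[OF S] by blast
  then show ?thesis by (simp add: inversion_def)
qed

lemma inversion_maximal_subgroup:
  assumes S: "topological_semigroup X m" and e: "e \<in> idempotents X m" and x: "x \<in> maximal_subgroup X m e"
  shows "inversion X m x \<in> maximal_subgroup X m e" "m x (inversion X m x) = e" "m (inversion X m x) x = e"
    "m e x = x" "m x e = x"
proof -
  interpret G: Group.group "maximal_group X m e" by (rule group_maximal_group[OF S e])
  note c = inversion_eq_inv[OF assms] maximal_group_def[of X m e]
  show "inversion X m x \<in> maximal_subgroup X m e"
    using G.inv_closed[of x] x unfolding c(1) by (simp add: c(2))
  show "m x (inversion X m x) = e" "m (inversion X m x) x = e"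
    using G.r_inv[of x] G.l_inv[of x] x unfolding c(1) by (simp_all add: c(2))
  show "m e x = x" "m x e = x"
    using G.r_one[of x] G.l_one[of x] x by (simp_all add: c(2))
qed

lemma group_inverse_inversion:
  assumes S: "topological_semigroup X m" and x: "x \<in> clifford_part X m"
  shows "inversion X m x \<in> clifford_part X m" "group_inverse m x (inversion X m x)"
    "projection X m x \<in> idempotents X m"
proof -
  obtain e where e: "e \<in> idempotents X m" "x \<in> maximal_subgroup X m e"
    using x by (auto simp: clifford_part_def)
  note i = inversion_maximal_subgroup[OF S e]
  show "inversion X m x \<in> clifford_part X m" using i(1) e(1) by (auto simp: clifford_part_def)
  show "group_inverse m x (inversion X m x)"
    using i inversion_maximal_subgroup(4)[OF S e(1) i(1)] by (simp add: group_inverse_def)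
  show "projection X m x \<in> idempotents X m" using i(2) e(1) by (simp add: projection_def)
qed

lemma clifford_part_subset:
  assumes "topological_semigroup X m"
  shows "clifford_part X m \<subseteq> topspace X"
  using maximal_subgroup_subset[OF assms] by (auto simp: clifford_part_def)

text \<open>The relation is three equations between continuous maps into a Hausdorff space.\<close>

lemma closedin_group_inverse:
  assumes S: "topological_semigroup K n" and a: "continuous_map T K a" and b: "continuous_map T K b"
  shows "closedin T {t \<in> topspace T. group_inverse n (a t) (b t)}"
proof -
  have H: "Hausdorff_space K" and c: "continuous_map (prod_topology K K) K (\<lambda>(x, y). n x y)"
    using S by (simp_all add: topological_semigroup_def)
  note op = continuous_map_op[OF c]
  have "{t \<in> topspace T. group_inverse n (a t) (b t)} =
      {t \<in> topspace T. n (n (a t) (b t)) (a t) = a t} \<inter>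
      ({t \<in> topspace T. n (n (b t) (a t)) (b t) = b t} \<inter> {t \<in> topspace T. n (a t) (b t) = n (b t) (a t)})"
    by (auto simp: group_inverse_def)
  also have "closedin T \<dots>"
    by (intro closedin_Int closedin_continuous_maps_eq[OF H] op a b)
  finally show ?thesis .
qed

text \<open>A closed graph argument: projecting along the compact factor \<open>K\<close> is a
  closed map, and by uniqueness the only group inverse of \<open>h x\<close> in all of
  \<open>K\<close> is the image of the inverse of \<open>x\<close>.\<close>

lemma continuous_inversion:
  assumes S: "topological_semigroup X m" and K: "topological_semigroup K n" "compact_space K"
    and h: "semigroup_embedding X m K n h"
  shows "continuous_map (subtopology X (clifford_part X m)) (subtopology X (clifford_part X m)) (inversion X m)"
proof -
  define C where "C = clifford_part X m"
  have CX: "C \<subseteq> topspace X" using clifford_part_subset[OF S] by (simp add: C_def)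
  define Y where "Y = subtopology X C"
  have topY: "topspace Y = C" using CX by (auto simp: Y_def)
  define i where "i = inversion X m"
  have i: "i x \<in> C" "group_inverse m x (i x)" if "x \<in> C" for x
    using group_inverse_inversion[OF S] that by (auto simp: C_def i_def)
  have emb: "embedding_map X K h" and hom: "\<And>x y. x \<in> topspace X \<Longrightarrow> y \<in> topspace X \<Longrightarrow> h (m x y) = n (h x) (h y)"
    using h by (auto simp: semigroup_embedding_def)
  have hc: "continuous_map X K h" by (rule embedding_map_imp_continuous_map[OF emb])
  have hX: "h x \<in> topspace K" if "x \<in> topspace X" for x
    using continuous_map_image_subset_topspace[OF hc] that by auto
  have hi: "group_inverse n (h x) (h (i x))" if "x \<in> C" for x
  proof -
    have "x \<in> topspace X" "i x \<in> topspace X" using that i(1) CX by auto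
    with i(2)[OF that] show ?thesis unfolding group_inverse_def
      by (metis hom topological_semigroup_closed[OF S])
  qed
  define T where "T = prod_topology Y K"
  have "continuous_map T X fst"
    unfolding T_def Y_def using continuous_map_fst by (metis continuous_map_in_subtopology)
  from continuous_map_compose[OF this hc] have c: "continuous_map T K (\<lambda>t. h (fst t))" "continuous_map T K snd"
    by (simp_all add: o_def T_def continuous_map_snd)
  have "continuous_map Y K (\<lambda>x. h (i x))"
    unfolding continuous_map_closedin
  proof (intro conjI ballI allI impI)
    show "(\<lambda>x. h (i x)) \<in> topspace Y \<rightarrow> topspace K"
      using i CX hX by (auto simp: topY)
    fix B assume B: "closedin K B"
    \<comment> \<open>The part of the closed relation lying over \<open>B\<close>; its projection to
      \<open>Y\<close> is exactly the preimage of \<open>B\<close>.\<close>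
    let ?R = "{t \<in> topspace T. group_inverse n (h (fst t)) (snd t)} \<inter> {t \<in> topspace T. snd t \<in> B}"
    have "closedin T ?R"
      by (intro closedin_Int closedin_group_inverse[OF K(1)] c closedin_continuous_map_preimage[OF c(2) B])
    then have "closedin Y (fst ` ?R)"
      using closed_map_fst[OF K(2), of Y] by (simp add: T_def closed_map_def)
    moreover have "fst ` ?R = {x \<in> topspace Y. h (i x) \<in> B}"
    proof (intro equalityI subsetI)
      fix x assume "x \<in> fst ` ?R"
      then obtain z where z: "x \<in> C" "z \<in> topspace K" "group_inverse n (h x) z" "z \<in> B"
        by (auto simp: T_def topY)
      have "h (i x) = z"
        by (rule group_inverse_unique[OF K(1) _ _ z(2) hi[OF z(1)] z(3)]) (use z(1) i(1) hX CX in auto)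
      with z show "x \<in> {x \<in> topspace Y. h (i x) \<in> B}" by (simp add: topY)
    next
      fix x assume "x \<in> {x \<in> topspace Y. h (i x) \<in> B}"
      then have x: "x \<in> C" "h (i x) \<in> B" by (auto simp: topY)
      then have "(x, h (i x)) \<in> ?R" using hi[OF x(1)] i(1)[OF x(1)] hX[of "i x"] CX
        by (auto simp: T_def topY)
      from imageI[OF this, of fst] show "x \<in> fst ` ?R" unfolding fst_conv .
    qed
    ultimately show "closedin Y {x \<in> topspace Y. h (i x) \<in> B}" by simp
  qed
  \<comment> \<open>Continuity into \<open>K\<close> is pulled back to \<open>X\<close>, whose
    topology is induced by \<open>h\<close>.\<close>
  then have "continuous_map Y X i"
    by (rule continuous_map_into_embedding[OF emb, rotated]) (use i(1) CX in \<open>auto simp: topY\<close>)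
  then have "continuous_map Y Y i"
    unfolding Y_def by (rule continuous_map_into_subtopology) (use i(1) in auto)
  then show ?thesis by (simp add: Y_def C_def i_def)
qed

lemma continuous_projection:
  assumes S: "topological_semigroup X m"
    and i: "continuous_map (subtopology X (clifford_part X m)) (subtopology X (clifford_part X m)) (inversion X m)"
  shows "continuous_map (subtopology X (clifford_part X m)) (subtopology X (idempotents X m)) (projection X m)"
proof (rule continuous_map_into_subtopology)
  have c: "continuous_map (prod_topology X X) X (\<lambda>(x, y). m x y)"
    using S by (simp add: topological_semigroup_def)
  have "continuous_map (subtopology X (clifford_part X m)) X (\<lambda>x. m x (inversion X m x))"
    by (rule continuous_map_op[OF c])
      (use i in \<open>auto simp: continuous_map_in_subtopology continuous_map_from_subtopology\<close>)
  then show "continuous_map (subtopology X (clifford_part X m)) X (projection X m)"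
    by (rule continuous_map_eq) (simp add: projection_def)
qed (use group_inverse_inversion(3)[OF S] in auto)

section \<open>Total boundedness of the maximal subgroups\<close>

lemma topological_group_maximal_group:
  assumes S: "topological_semigroup X m" and e: "e \<in> idempotents X m"
    and i: "continuous_map (subtopology X (clifford_part X m)) (subtopology X (clifford_part X m)) (inversion X m)"
  shows "topological_group (subtopology X (maximal_subgroup X m e)) (maximal_group X m e)"
proof -
  define H where "H = maximal_subgroup X m e"
  have HX: "H \<subseteq> topspace X" using maximal_subgroup_subset[OF S e] by (simp add: H_def)
  interpret G: Group.group "maximal_group X m e" by (rule group_maximal_group[OF S e])
  have car: "carrier (maximal_group X m e) = H" and mul: "mult (maximal_group X m e) = m"
    by (simp_all add: maximal_group_def H_def)
  define Y where "Y = subtopology X H"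
  have topY: "topspace Y = H" using HX by (auto simp: Y_def)
  have c: "continuous_map (prod_topology X X) X (\<lambda>(x, y). m x y)"
    using S by (simp add: topological_semigroup_def)
  have id: "continuous_map Y X (\<lambda>x. x)" by (simp add: Y_def continuous_map_from_subtopology)
  have fs: "continuous_map (prod_topology Y Y) X fst" "continuous_map (prod_topology Y Y) X snd"
    using continuous_map_compose[OF continuous_map_fst id, of Y] continuous_map_compose[OF continuous_map_snd id, of Y]
    by (simp_all add: o_def)
  have "continuous_map (prod_topology Y Y) Y (\<lambda>t. m (fst t) (snd t))"
    unfolding Y_def
  proof (rule continuous_map_into_subtopology)
    show "continuous_map (prod_topology (subtopology X H) (subtopology X H)) X (\<lambda>t. m (fst t) (snd t))"
      using continuous_map_op[OF c fs] by (simp add: Y_def)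
    show "(\<lambda>t. m (fst t) (snd t)) \<in> topspace (prod_topology (subtopology X H) (subtopology X H)) \<rightarrow> H"
      using G.m_closed unfolding car mul by auto
  qed
  moreover have "continuous_map Y Y (\<lambda>x. inv\<^bsub>maximal_group X m e\<^esub> x)"
  proof -
    have "H \<subseteq> clifford_part X m" using e by (auto simp: H_def clifford_part_def)
    then have "continuous_map Y X (inversion X m)"
      using i by (metis Y_def continuous_map_from_subtopology_mono continuous_map_in_subtopology)
    then have "continuous_map Y X (\<lambda>x. inv\<^bsub>maximal_group X m e\<^esub> x)"
      by (rule continuous_map_eq) (use inversion_eq_inv[OF S e] topY H_def in auto)
    then show ?thesis unfolding Y_def
      by (rule continuous_map_into_subtopology) (use G.inv_closed car in auto)
  qed
  moreover have "Hausdorff_space Y"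
    using S by (simp add: Y_def topological_semigroup_def Hausdorff_space_subtopology)
  ultimately show ?thesis
    using G.group_axioms unfolding topological_group_def
    by (simp add: car mul topY Y_def[symmetric] H_def[symmetric] case_prod_unfold)
qed

text \<open>Each \<open>g\<close> in the group yields the point \<open>(h g, h (i g))\<close> of a
  compact set. If \<open>g\<close> and \<open>a\<close> fall into the same box of a suitable cover,
  then \<open>m (i a) g\<close> is in \<open>U\<close>, so \<open>g\<close> is in the translate of
  \<open>U\<close> by \<open>a\<close>; one \<open>a\<close> per box suffices.\<close>

lemma totally_bounded_maximal_group:
  assumes S: "topological_semigroup X m" and K: "topological_semigroup K n" "compact_space K"
    and h: "semigroup_embedding X m K n h" and e: "e \<in> idempotents X m"
  shows "totally_bounded_group (subtopology X (maximal_subgroup X m e)) (maximal_group X m e)"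
  unfolding totally_bounded_group_def
proof (intro conjI allI impI)
  show "topological_group (subtopology X (maximal_subgroup X m e)) (maximal_group X m e)"
    by (rule topological_group_maximal_group[OF S e continuous_inversion[OF S K h]])
  define H where "H = maximal_subgroup X m e"
  have HX: "H \<subseteq> topspace X" using maximal_subgroup_subset[OF S e] by (simp add: H_def)
  interpret G: Group.group "maximal_group X m e" by (rule group_maximal_group[OF S e])
  have car: "carrier (maximal_group X m e) = H" and mul: "mult (maximal_group X m e) = m"
    and one: "one (maximal_group X m e) = e"
    by (simp_all add: maximal_group_def H_def)
  define i where "i = inversion X m"
  have i: "i x \<in> H" "m x (i x) = e" "m (i x) x = e" "m e x = x" if "x \<in> H" for x
    using inversion_maximal_subgroup[OF S e] that by (simp_all add: H_def i_def)
  have emb: "embedding_map X K h" and hom: "\<And>x y. x \<in> topspace X \<Longrightarrow> y \<in> topspace X \<Longrightarrow> h (m x y) = n (h x) (h y)"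
    using h by (auto simp: semigroup_embedding_def)
  have hc: "continuous_map X K h" by (rule embedding_map_imp_continuous_map[OF emb])
  have hX: "h x \<in> topspace K" if "x \<in> topspace X" for x
    using continuous_map_image_subset_topspace[OF hc] that by auto
  have HK: "Hausdorff_space K" and nc: "continuous_map (prod_topology K K) K (\<lambda>(x, y). n x y)"
    using K(1) by (simp_all add: topological_semigroup_def)
  fix U assume "openin (subtopology X (maximal_subgroup X m e)) U \<and> \<one>\<^bsub>maximal_group X m e\<^esub> \<in> U"
  then have U: "openin (subtopology X H) U" "e \<in> U" by (simp_all add: H_def one)
  then obtain W where W: "openin X W" "U = W \<inter> H" by (auto simp: openin_subtopology)
  obtain W' where W': "openin K W'" "\<And>x. x \<in> topspace X \<Longrightarrow> h x \<in> W' \<longleftrightarrow> x \<in> W"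
    using embedding_map_openin[OF emb W(1)] by blast
  define T where "T = prod_topology K K"
  \<comment> \<open>The factors are reversed so that combining the second coordinate of one point
    with the first of another gives a product of the form \<open>m (i a) g\<close>.\<close>
  define \<Gamma> where "\<Gamma> = {t \<in> topspace T. n (snd t) (fst t) = h e}"
  have swap: "continuous_map T K (\<lambda>t. n (snd t) (fst t))"
    unfolding T_def by (rule continuous_map_op[OF nc continuous_map_snd continuous_map_fst])
  have "closedin T \<Gamma>"
    unfolding \<Gamma>_def by (rule closedin_continuous_maps_eq[OF HK swap]) (use hX idempotents_topspace[OF e] in auto)
  then have comp: "compactin T \<Gamma>"
    using K(2) by (intro closedin_compact_space) (simp_all add: T_def compact_space_prod_topology)
  have he_W: "h e \<in> W'" using W'(2)[OF idempotents_topspace[OF e]] U(2) W(2) by simp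
  have box: "\<exists>A B. openin K A \<and> openin K B \<and> t \<in> A \<times> B \<and> (\<forall>x\<in>A. \<forall>y\<in>B. n y x \<in> W')" if "t \<in> \<Gamma>" for t
  proof -
    have op: "openin T {t \<in> topspace T. n (snd t) (fst t) \<in> W'}"
      by (rule openin_continuous_map_preimage[OF swap W'(1)])
    have "(fst t, snd t) \<in> {t \<in> topspace T. n (snd t) (fst t) \<in> W'}"
      using that he_W by (simp add: \<Gamma>_def)
    with op obtain A B where "openin K A" "openin K B" "fst t \<in> A" "snd t \<in> B"
      "A \<times> B \<subseteq> {t \<in> topspace T. n (snd t) (fst t) \<in> W'}"
      unfolding T_def openin_prod_topology_alt by meson
    then show ?thesis by (intro exI[of _ A] exI[of _ B]) (auto simp: mem_Times_iff)
  qed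
  define \<U> where "\<U> = {A \<times> B | A B. openin K A \<and> openin K B \<and> (\<forall>x\<in>A. \<forall>y\<in>B. n y x \<in> W')}"
  have "\<Gamma> \<subseteq> \<Union>\<U>" using box unfolding \<U>_def by blast
  moreover have "\<And>O'. O' \<in> \<U> \<Longrightarrow> openin T O'" by (auto simp: \<U>_def T_def openin_prod_Times_iff)
  ultimately obtain F where F: "finite F" "F \<subseteq> \<U>" "\<Gamma> \<subseteq> \<Union>F"
    using comp unfolding compactin_def by meson
  \<comment> \<open>Only boxes containing the pair of some group element are kept, so that a
    representative in \<open>H\<close> can be chosen in each.\<close>
  define F' where "F' = {V \<in> F. \<exists>c\<in>H. (h c, h (i c)) \<in> V}"
  have "\<forall>V\<in>F'. \<exists>c. c \<in> H \<and> (h c, h (i c)) \<in> V" by (auto simp: F'_def)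
  then obtain c where c: "\<And>V. V \<in> F' \<Longrightarrow> c V \<in> H" "\<And>V. V \<in> F' \<Longrightarrow> (h (c V), h (i (c V))) \<in> V"
    by metis
  show "\<exists>A. finite A \<and> A \<subseteq> carrier (maximal_group X m e) \<and>
      A <#>\<^bsub>maximal_group X m e\<^esub> U = carrier (maximal_group X m e)"
  proof (intro exI conjI)
    show "finite (c ` F')" using F(1) by (simp add: F'_def)
    show A: "c ` F' \<subseteq> carrier (maximal_group X m e)" using c(1) by (auto simp: car)
    show "c ` F' <#>\<^bsub>maximal_group X m e\<^esub> U = carrier (maximal_group X m e)"
    proof
      show "c ` F' <#>\<^bsub>maximal_group X m e\<^esub> U \<subseteq> carrier (maximal_group X m e)"
        using A W(2) by (intro G.set_mult_closed) (auto simp: car)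
      show "carrier (maximal_group X m e) \<subseteq> c ` F' <#>\<^bsub>maximal_group X m e\<^esub> U"
      proof
        fix g assume "g \<in> carrier (maximal_group X m e)"
        then have g: "g \<in> H" by (simp add: car)
        have gX: "g \<in> topspace X" "i g \<in> topspace X" using g i(1) HX by auto
        have "n (h (i g)) (h g) = h e" using hom[OF gX(2,1)] i(3)[OF g] by simp
        then have "(h g, h (i g)) \<in> \<Gamma>" using gX hX by (simp add: \<Gamma>_def T_def)
        then obtain V where V: "V \<in> F" "(h g, h (i g)) \<in> V" using F(3) by blast
        then have VF: "V \<in> F'" using g by (auto simp: F'_def)
        define a where "a = c V"
        have a: "a \<in> H" "(h a, h (i a)) \<in> V" using c VF by (simp_all add: a_def)
        have aX: "a \<in> topspace X" "i a \<in> topspace X" using a(1) i(1) HX by auto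
        \<comment> \<open>The defining condition of the boxes allows the two coordinates to come
          from different points of the same box.\<close>
        have "n (h (i a)) (h g) \<in> W'"
          using V a(2) F(2) unfolding \<U>_def by blast
        then have "m (i a) g \<in> W"
          using hom[OF aX(2) gX(1)] W'(2)[OF topological_semigroup_closed[OF S aX(2) gX(1)]] by simp
        moreover have "m (i a) g \<in> H"
          using G.m_closed[of "i a" g] i(1)[OF a(1)] g by (simp add: car mul)
        ultimately have "m (i a) g \<in> U" using W(2) by simp
        moreover have "g = m a (m (i a) g)"
          using topological_semigroup_assoc[OF S aX gX(1)] i(2)[OF a(1)] i(4)[OF g] by simp
        ultimately show "g \<in> c ` F' <#>\<^bsub>maximal_group X m e\<^esub> U"
          using VF unfolding set_mult_def mul a_def by blast
      qed
    qed
  qed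
qed

theorem theorem1:
  fixes X :: "'a topology" and m :: "'a \<Rightarrow> 'a \<Rightarrow> 'a"
  assumes "topological_semigroup X m"
    and "tychonoff_space X"
    and "pseudocompact_space (prod_topology X X)"
  shows "(\<exists>(K :: (('a \<Rightarrow> real) \<Rightarrow> real) topology) n h.
            topological_semigroup K n \<and> compact_space K \<and> semigroup_embedding X m K n h) \<and>
         continuous_map (subtopology X (clifford_part X m)) (subtopology X (clifford_part X m))
           (inversion X m) \<and>
         continuous_map (subtopology X (clifford_part X m)) (subtopology X (idempotents X m))
           (projection X m) \<and>
         (\<forall>e\<in>idempotents X m.
            totally_bounded_group (subtopology X (maximal_subgroup X m e)) (maximal_group X m e))"
proof -
  obtain K :: "(('a \<Rightarrow> real) \<Rightarrow> real) topology" and n h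
    where K: "topological_semigroup K n" "compact_space K" "semigroup_embedding X m K n h"
    by (rule pseudocompact_square_semigroup_compactification[OF assms])
  \<comment> \<open>The same \<open>K\<close> serves for the embedding, for continuity of the
    inversion and for total boundedness.\<close>
  note inv = continuous_inversion[OF assms(1) K]
  show ?thesis
    using K inv continuous_projection[OF assms(1) inv] totally_bounded_maximal_group[OF assms(1) K]
    by blast
qed

end
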